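(* For all positive integers $k$ and $r$, $g_3(k,r)=r\binom{k}{\lfloor k/2\rfloor}$.
   Context: Model 3 (non-adaptive, $r+2$ players $A,B,C_1,\dots,C_r$, $r\ge 1$). Player $A$ chooses an unknown defective element $d$ of a finite set $X$. A query is an ordered $r$-tuple $(X_1,\dots,X_r)$ of pairwise disjoint subsets of $X$ (their union need not be $X$); Player $B$ chooses all $k$ queries at once. For each query, if $d\in X_i$ then Player $C_i$ is given the set $X_i$ (a YES answer together with the set); the players $C_i$ have no other information about the queries. Player $C_i$ can identify $d$ iff $d$ is the unique element of $X$ contained in every set given to $C_i$ (if $C_i$ is given no sets, this means $X=\{d\}$). A collection of queries solves Model 3 if for every choice of $d\in X$ at least one player $C_i$ can identify $d$. $g_3(k,r)$ denotes the largest $n$ such that on an $n$-element set there are $k$ queries solving Model 3. *)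

theory Defs
  imports Complex_Main
begin

text \<open>
  A family of \<open>k\<close> queries for \<open>r\<close> answering players is a function \<open>Q\<close>, where \<open>Q j i\<close>
  (for \<open>j < k\<close>, \<open>i < r\<close>) is the \<open>i\<close>-th component of the \<open>j\<close>-th query. Players and queries
  are numbered from 0; values of \<open>Q\<close> outside these ranges are irrelevant. Queries may repeat,
  and components may be empty.
\<close>

definition is_query :: "'a set \<Rightarrow> nat \<Rightarrow> (nat \<Rightarrow> 'a set) \<Rightarrow> bool" where
  "is_query X r q \<longleftrightarrow>
     (\<forall>i<r. q i \<subseteq> X) \<and> (\<forall>i<r. \<forall>i'<r. i \<noteq> i' \<longrightarrow> q i \<inter> q i' = {})"

definition given_sets :: "nat \<Rightarrow> (nat \<Rightarrow> nat \<Rightarrow> 'a set) \<Rightarrow> nat \<Rightarrow> 'a \<Rightarrow> 'a set set" where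
  "given_sets k Q i d = {Q j i | j. j < k \<and> d \<in> Q j i}"

definition can_identify :: "'a set \<Rightarrow> nat \<Rightarrow> (nat \<Rightarrow> nat \<Rightarrow> 'a set) \<Rightarrow> nat \<Rightarrow> 'a \<Rightarrow> bool" where
  "can_identify X k Q i d \<longleftrightarrow> {x \<in> X. \<forall>S \<in> given_sets k Q i d. x \<in> S} = {d}"

definition solves_model3 :: "'a set \<Rightarrow> nat \<Rightarrow> nat \<Rightarrow> (nat \<Rightarrow> nat \<Rightarrow> 'a set) \<Rightarrow> bool" where
  "solves_model3 X k r Q \<longleftrightarrow>
     (\<forall>j<k. is_query X r (Q j)) \<and> (\<forall>d\<in>X. \<exists>i<r. can_identify X k Q i d)"

text \<open>Only the size of the ground set matters, so it is taken to consist of natural numbers.\<close>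

definition solvable_size :: "nat \<Rightarrow> nat \<Rightarrow> nat \<Rightarrow> bool" where
  "solvable_size k r n \<longleftrightarrow>
     (\<exists>(X :: nat set) Q. finite X \<and> card X = n \<and> solves_model3 X k r Q)"

definition g3 :: "nat \<Rightarrow> nat \<Rightarrow> nat" where
  "g3 k r = (GREATEST n. solvable_size k r n)"

text \<open>
  The maximum exists, so \<open>GREATEST\<close> never takes an unspecified value: an element identified by
  player \<open>i\<close> is determined by \<open>i\<close> and the indices of the queries player \<open>i\<close> sees answered.
\<close>

lemma solvable_size_bounded:
  assumes "solvable_size k r n"
  shows "n \<le> r * 2 ^ k"
proof -
  obtain X :: "nat set" and Q where X: "finite X" "card X = n" "solves_model3 X k r Q"
    using assms unfolding solvable_size_def by blast
  then have "\<forall>d\<in>X. \<exists>i. i < r \<and> can_identify X k Q i d"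
    unfolding solves_model3_def by simp
  from bchoice[OF this] obtain p where
    p: "\<And>d. d \<in> X \<Longrightarrow> p d < r \<and> can_identify X k Q (p d) d"
    by blast
  define F where "F d = (p d, {j. j < k \<and> d \<in> Q j (p d)})" for d
  have "inj_on F X"
  proof (rule inj_onI)
    fix x y assume xy: "x \<in> X" "y \<in> X" "F x = F y"
    have "p x = p y \<and> {j. j < k \<and> x \<in> Q j (p x)} = {j. j < k \<and> y \<in> Q j (p y)}"
      using xy(3) unfolding F_def prod.inject .
    then have px: "p x = p y"
      and px': "{j. j < k \<and> x \<in> Q j (p x)} = {j. j < k \<and> y \<in> Q j (p y)}"
      by (rule conjunct1, rule conjunct2)
    have same: "j < k \<and> x \<in> Q j (p x) \<longleftrightarrow> j < k \<and> y \<in> Q j (p x)" for j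
      using px' unfolding px set_eq_iff mem_Collect_eq by (rule spec)
    have "\<forall>S \<in> given_sets k Q (p x) x. y \<in> S"
      unfolding given_sets_def
    proof
      fix S assume "S \<in> {Q j (p x) | j. j < k \<and> x \<in> Q j (p x)}"
      then obtain j where "S = Q j (p x)" "j < k \<and> x \<in> Q j (p x)" by blast
      then show "y \<in> S" using same[of j] by simp
    qed
    then have "y \<in> {z \<in> X. \<forall>S \<in> given_sets k Q (p x) x. z \<in> S}"
      using xy(2) by simp
    also have "\<dots> = {x}"
      using conjunct2[OF p[OF xy(1)]] unfolding can_identify_def .
    finally show "x = y"
      by simp
  qed
  moreover have "F ` X \<subseteq> {..<r} \<times> Pow {..<k}"
  proof (rule image_subsetI)
    fix x assume "x \<in> X"
    then have "p x < r"
      using p[of x] by simp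
    then show "F x \<in> {..<r} \<times> Pow {..<k}"
      unfolding F_def by auto
  qed
  ultimately have "card X \<le> card ({..<r} \<times> Pow {..<k})"
    by (rule card_inj_on_le) simp
  then show ?thesis
    using X by (simp add: card_cartesian_product card_Pow)
qed

lemma solvable_size_0: "solvable_size k r 0"
  unfolding solvable_size_def solves_model3_def is_query_def
  by (intro exI[of _ "{}"] exI[of _ "\<lambda>_ _. {}"]) auto

lemma solvable_size_g3: "solvable_size k r (g3 k r)"
  unfolding g3_def
  using GreatestI_nat[of "solvable_size k r" 0 "r * 2 ^ k"] solvable_size_0 solvable_size_bounded
  by blast

lemma solvable_size_le_g3: "solvable_size k r n \<Longrightarrow> n \<le> g3 k r"
  unfolding g3_def
  using Greatest_le_nat[of "solvable_size k r" n "r * 2 ^ k"] solvable_size_bounded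
  by blast

end

theory Submission
  imports Defs "HOL-Combinatorics.Multiset_Permutations"
begin

text \<open>
  Player \<open>i\<close> identifies \<open>d\<close> iff the index set \<open>{j. d \<in> Q j i}\<close> is not contained in the index set of
  any other element, so the elements identified by a fixed player have distinct index sets forming
  an antichain, and Sperner's theorem bounds their number. Conversely, give each player a private
  copy of a middle layer of the Boolean lattice on the \<open>k\<close> queries, the private elements of one
  player never being shown to another. The layer has to consist of nonempty sets for every private
  element to be separated from those of the other players, so it is the one of size \<open>k - k div 2\<close>
  (for \<open>k = 1\<close>, layer \<open>k div 2\<close> contains only the empty set).
\<close>

text \<open>
  Lubell's proof: \<open>S\<close> is an initial segment of \<open>|S|! (n - |S|)!\<close> linear orderings of \<open>U\<close>, and
  no ordering has two members of an antichain as initial segments.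
\<close>

lemma card_permutations_initial_segment:
  assumes "finite U" "S \<subseteq> U"
  shows "card {xs \<in> permutations_of_set U. set (take (card S) xs) = S}
           = fact (card S) * fact (card U - card S)"
proof -
  have fin: "finite S" "finite (U - S)"
    using assms finite_subset by auto
  let ?app = "\<lambda>(ys, zs). ys @ zs"
  let ?P = "permutations_of_set S \<times> permutations_of_set (U - S)"
  \<comment> \<open>Cutting an ordering after \<open>card S\<close> entries leaves an ordering of
    \<open>S\<close> followed by one of \<open>U - S\<close>.\<close>
  have "{xs \<in> permutations_of_set U. set (take (card S) xs) = S} = ?app ` ?P"
  proof (intro equalityI subsetI)
    fix xs assume "xs \<in> {xs \<in> permutations_of_set U. set (take (card S) xs) = S}"
    then have xs: "set xs = U" "distinct xs" "set (take (card S) xs) = S"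
      by (auto dest: permutations_of_setD)
    have "set (drop (card S) xs) = U - S"
      using xs set_take_disj_set_drop_if_distinct[OF xs(2), of "card S" "card S"]
        set_append[of "take (card S) xs" "drop (card S) xs"]
      by auto
    then have "(take (card S) xs, drop (card S) xs) \<in> ?P"
      using xs by auto
    then show "xs \<in> ?app ` ?P"
      by (rule rev_image_eqI) simp
  next
    fix xs assume "xs \<in> ?app ` ?P"
    then obtain ys zs where yz: "xs = ys @ zs" "ys \<in> permutations_of_set S"
        "zs \<in> permutations_of_set (U - S)"
      by auto
    have "distinct xs" "set xs = U"
      using permutations_of_setD[OF yz(2)] permutations_of_setD[OF yz(3)] yz(1) assms(2)
      by (simp_all add: Un_absorb1)
    moreover have "take (card S) xs = ys"
      using length_finite_permutations_of_set[OF yz(2)] yz(1) by simp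
    ultimately show "xs \<in> {xs \<in> permutations_of_set U. set (take (card S) xs) = S}"
      using permutations_of_setD(1)[OF yz(2)] by (simp add: permutations_of_setI)
  qed
  \<comment> \<open>All first components have length \<open>card S\<close>, so the cut can be
    recovered.\<close>
  moreover have "inj_on ?app ?P"
    by (auto simp: inj_on_def dest!: length_finite_permutations_of_set)
  ultimately show ?thesis
    using assms fin by (simp add: card_image card_cartesian_product card_Diff_subset)
qed

lemma lubell_yamamoto_meshalkin:
  assumes "finite U" "F \<subseteq> Pow U"
    and antichain: "\<And>S T. S \<in> F \<Longrightarrow> T \<in> F \<Longrightarrow> S \<subseteq> T \<Longrightarrow> S = T"
  shows "(\<Sum>S\<in>F. fact (card S) * fact (card U - card S)) \<le> (fact (card U) :: nat)"
proof -
  let ?I = "\<lambda>S. {xs \<in> permutations_of_set U. set (take (card S) xs) = S}"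
  have "finite F"
    using assms(1,2) by (simp add: finite_subset)
  have disj: "?I S \<inter> ?I T = {}" if "S \<in> F" "T \<in> F" "S \<noteq> T" for S T
  proof (rule ccontr)
    assume "?I S \<inter> ?I T \<noteq> {}"
    then obtain xs where "xs \<in> ?I S \<inter> ?I T"
      unfolding ex_in_conv[symmetric] ..
    then have xs: "set (take (card S) xs) = S" "set (take (card T) xs) = T"
      by simp_all
    \<comment> \<open>Of two initial segments of one list, the shorter lies in the longer.\<close>
    have "S \<subseteq> T \<or> T \<subseteq> S"
      using set_take_subset_set_take[of "card S" "card T" xs]
        set_take_subset_set_take[of "card T" "card S" xs] xs by (metis nat_le_linear)
    then show False
      using antichain[of S T] antichain[of T S] that by auto
  qed
  have "(\<Sum>S\<in>F. fact (card S) * fact (card U - card S)) = (\<Sum>S\<in>F. card (?I S))"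
    using assms(1,2) by (intro sum.cong refl card_permutations_initial_segment[symmetric]) blast+
  also have "\<dots> = card (\<Union>S\<in>F. ?I S)"
    using \<open>finite F\<close> disj by (intro card_UN_disjoint[symmetric]) (blast | simp)+
  also have "\<dots> \<le> card (permutations_of_set U)"
    by (rule card_mono) (simp, blast)
  finally show ?thesis
    using assms(1) by simp
qed

text \<open>The weights of \<open>lubell_yamamoto_meshalkin\<close> sum to at most n!, and each is
  at least n! divided by the largest binomial coefficient. Multiplying out keeps this in the
  naturals.\<close>

theorem sperner:
  assumes "finite U" "F \<subseteq> Pow U"
    and "\<And>S T. S \<in> F \<Longrightarrow> T \<in> F \<Longrightarrow> S \<subseteq> T \<Longrightarrow> S = T"
  shows "card F \<le> card U choose (card U div 2)"
proof -
  let ?n = "card U"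
  let ?w = "\<lambda>S :: 'a set. fact (card S) * fact (?n - card S) :: nat"
  have "fact ?n \<le> ?w S * (?n choose (?n div 2))" if "S \<in> F" for S
  proof -
    have "card S \<le> ?n"
      using assms(1,2) that by (auto intro: card_mono)
    then have "fact ?n = ?w S * (?n choose card S)"
      by (rule binomial_fact_lemma[symmetric])
    then show ?thesis
      using binomial_maximum[of ?n "card S"] by simp
  qed
  then have "card F * fact ?n \<le> (\<Sum>S\<in>F. ?w S * (?n choose (?n div 2)))"
    using sum_bounded_below[of F "fact ?n :: nat"] by simp
  also have "\<dots> \<le> fact ?n * (?n choose (?n div 2))"
    unfolding sum_distrib_right[symmetric]
    using lubell_yamamoto_meshalkin[OF assms] by (rule mult_le_mono1)
  finally show ?thesis
    by (simp add: mult.commute)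
qed

text \<open>The given sets carry no indices, but lying in all of them amounts to lying in
  \<open>Q j i\<close> for each index \<open>j\<close> of \<open>d\<close>, even when queries
  repeat.\<close>

lemma can_identify_iff:
  assumes "d \<in> X"
  shows "can_identify X k Q i d \<longleftrightarrow>
    (\<forall>x\<in>X. {j. j < k \<and> d \<in> Q j i} \<subseteq> {j. j < k \<and> x \<in> Q j i} \<longrightarrow> x = d)"
  using assms unfolding can_identify_def given_sets_def by blast

lemma card_identified_le:
  "card {d \<in> X. can_identify X k Q i d} \<le> k choose (k div 2)"
proof -
  let ?D = "{d \<in> X. can_identify X k Q i d}"
  let ?J = "\<lambda>d. {j. j < k \<and> d \<in> Q j i}"
  \<comment> \<open>This gives both the injectivity of \<open>?J\<close> and the antichain property
    of its image.\<close>
  have eq: "y = x" if "x \<in> ?D" "y \<in> ?D" "?J x \<subseteq> ?J y" for x y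
    using that can_identify_iff[of x X k Q i] by blast
  have "inj_on ?J ?D"
    by (rule inj_onI) (use eq in blast)
  then have "card ?D = card (?J ` ?D)"
    by (rule card_image[symmetric])
  also have "\<dots> \<le> card {..<k} choose (card {..<k} div 2)"
    by (rule sperner) (use eq in blast)+
  finally show ?thesis
    by simp
qed

lemma solvable_size_le:
  assumes "solvable_size k r n"
  shows "n \<le> r * (k choose (k div 2))"
proof -
  obtain X :: "nat set" and Q where X: "finite X" "card X = n" "solves_model3 X k r Q"
    using assms unfolding solvable_size_def by blast
  let ?D = "\<lambda>i. {d \<in> X. can_identify X k Q i d}"
  have "X = (\<Union>i<r. ?D i)"
    using X(3) unfolding solves_model3_def by blast
  then have "n \<le> (\<Sum>i<r. card (?D i))"
    using X(2) card_UN_le[of "{..<r}" ?D] by simp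
  also have "\<dots> \<le> r * (k choose (k div 2))"
    using sum_bounded_above[of "{..<r}" "\<lambda>i. card (?D i)", OF card_identified_le] by simp
  finally show ?thesis .
qed

lemma solvable_size_middle_layer:
  assumes "k > 0"
  shows "solvable_size k r (r * (k choose (k div 2)))"
proof -
  let ?L = "{T. T \<subseteq> {..<k} \<and> card T = k - k div 2}"
  let ?P = "{..<r} \<times> ?L"
  let ?n = "r * (k choose (k div 2))"
  have "finite ?L"
    by (rule finite_subset[of _ "Pow {..<k}"]) auto
  moreover have "card ?L = k choose (k div 2)"
    using n_subsets[of "{..<k}" "k - k div 2"] binomial_symmetric[of "k div 2" k] by simp
  ultimately obtain f where f: "bij_betw f {..<?n} ?P"
    using ex_bij_betw_nat_finite[of ?P] by (auto simp: card_cartesian_product atLeast0LessThan)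
  \<comment> \<open>Each \<open>x\<close> is owned by player \<open>fst (f x)\<close> alone, which
    makes components disjoint; \<open>snd (f x)\<close> lists the queries that show it.\<close>
  define Q where "Q j i = {x \<in> {..<?n}. fst (f x) = i \<and> j \<in> snd (f x)}" for j i
  have "can_identify {..<?n} k Q (fst (f d)) d" if d: "d \<in> {..<?n}" for d
    unfolding can_identify_iff[OF d]
  proof (intro ballI impI)
    fix x
    assume x: "x \<in> {..<?n}"
      and sub: "{j. j < k \<and> d \<in> Q j (fst (f d))} \<subseteq> {j. j < k \<and> x \<in> Q j (fst (f d))}"
    have L: "snd (f d) \<in> ?L" "snd (f x) \<in> ?L"
      using bij_betwE[OF f] d x by (auto simp: mem_Times_iff)
    have in_Q: "fst (f x) = fst (f d) \<and> j \<in> snd (f x)" if "j \<in> snd (f d)" for j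
      using sub L(1) d that unfolding Q_def by blast
    \<comment> \<open>Some query shows \<open>d\<close> to its owner, and any \<open>x\<close> in
      the same component has that owner too.\<close>
    have "card (snd (f d)) > 0"
      using L(1) assms by auto
    then have "snd (f d) \<noteq> {}"
      by auto
    then have "fst (f x) = fst (f d)"
      using in_Q by blast
    \<comment> \<open>Both sets lie in one layer, so inclusion forces equality.\<close>
    moreover have "snd (f d) = snd (f x)"
      using L in_Q by (intro card_subset_eq) (auto intro: finite_subset)
    ultimately show "x = d"
      using f d x by (auto simp: bij_betw_def inj_on_def prod_eq_iff)
  qed
  moreover have "fst (f d) < r" if "d \<in> {..<?n}" for d
    using bij_betwE[OF f] that by (auto simp: mem_Times_iff)
  moreover have "is_query {..<?n} r (Q j)" for j
    unfolding is_query_def Q_def by blast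
  ultimately have "solves_model3 {..<?n} k r Q"
    unfolding solves_model3_def by blast
  then show ?thesis
    unfolding solvable_size_def by (intro exI[of _ "{..<?n}"] exI[of _ Q]) simp
qed

theorem theorem3:
  fixes k r :: nat
  assumes "k > 0" and "r > 0"
  shows "g3 k r = r * (k choose (k div 2))"
  using solvable_size_le[OF solvable_size_g3]
    solvable_size_le_g3[OF solvable_size_middle_layer[OF assms(1)]]
  by (rule antisym)

end
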